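(* For all $S,T\in\Sigma^\infty$, $$|\dim_{\mathrm{FS}}(S)-\dim_{\mathrm{FS}}(T)|\le\delta^+(S,T)\quad\text{and}\quad|\mathrm{Dim}_{\mathrm{FS}}(S)-\mathrm{Dim}_{\mathrm{FS}}(T)|\le\delta^+(S,T).$$
   Context: Let $k\ge2$ be an integer and $\Sigma=\{0,\ldots,k-1\}$; sequences are elements of $\Sigma^\infty$ indexed from $0$, and $S[i..j]$ is the string of symbols $i$ through $j$. Logarithms are base 2; the Shannon entropy of a probability measure $\pi$ on a finite set $\Omega$ is $H(\pi)=\sum_{w}\pi(w)\log\frac1{\pi(w)}$ with $0\log\frac10=0$. For $S\in\Sigma^\infty$ and positive integers $l,n$, let $\pi^{(l)}_{S,n}$ be the probability measure on $\Sigma^l$ with $\pi^{(l)}_{S,n}(w)=\frac1n|\{0\le j\le n-1: S[jl..(j+1)l-1]=w\}|$. Set $H^-_l(S)=\frac1{l\log k}\liminf_{n}H(\pi^{(l)}_{S,n})$, $H^+_l(S)=\frac1{l\log k}\limsup_n H(\pi^{(l)}_{S,n})$, $\dim_{\mathrm{FS}}(S)=\inf_{l\ge1}H^-_l(S)$ and $\mathrm{Dim}_{\mathrm{FS}}(S)=\inf_{l\ge1}H^+_l(S)$. For probability measures $\pi,\mu$ on a finite set $\Omega$, the logarithmic dispersion is $\delta(\pi,\mu)=\log m$, where $m$ is the least positive integer for which there is a nonnegative real matrix $A=(a_{xy})_{x,y\in\Omega}$ with every column summing to $1$, $\sum_y a_{xy}\pi(y)=\mu(x)$ for all $x$, and no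 row or column having more than $m$ nonzero entries. Finally $\delta^+(S,T)=\limsup_{l\to\infty}\frac{1}{l\log k}\limsup_{n\to\infty}\delta(\pi^{(l)}_{S,n},\pi^{(l)}_{T,n})$. *)

theory Defs
  imports Complex_Main "HOL-Library.Extended_Real" "HOL-Library.Liminf_Limsup"
begin

text \<open>
  The alphabet is \<open>{..<k}\<close>, sequences are functions \<open>nat \<Rightarrow> nat\<close> with range in the alphabet,
  and probability measures on a finite set \<open>\<Omega>\<close> are given by their point masses.
\<close>

definition words :: "nat \<Rightarrow> nat \<Rightarrow> nat list set" where
  "words k l = {w. set w \<subseteq> {..<k} \<and> length w = l}"

definition block :: "(nat \<Rightarrow> nat) \<Rightarrow> nat \<Rightarrow> nat \<Rightarrow> nat list" where
  "block S l j = map S [j * l..<(j + 1) * l]"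

definition block_freq :: "(nat \<Rightarrow> nat) \<Rightarrow> nat \<Rightarrow> nat \<Rightarrow> nat list \<Rightarrow> real" where
  "block_freq S l n w = real (card {j. j < n \<and> block S l j = w}) / real n"

text \<open>The convention \<open>0 log (1/0) = 0\<close> holds automatically, whatever the value of \<open>log 2 (1/0)\<close>.\<close>

definition shannon_entropy :: "'a set \<Rightarrow> ('a \<Rightarrow> real) \<Rightarrow> real" where
  "shannon_entropy \<Omega> \<pi> = (\<Sum>w\<in>\<Omega>. \<pi> w * log 2 (1 / \<pi> w))"

text \<open>
  Lower and upper limits are taken in the complete lattice \<open>ereal\<close>. The entropies lie between
  \<open>0\<close> and \<open>l log k\<close> and the dispersions likewise (see \<open>dispersion_witness_card\<close> below), so all
  the following quantities are in fact finite, and differences of dimensions are ordinary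
  real differences.
\<close>

definition H_lower :: "nat \<Rightarrow> nat \<Rightarrow> (nat \<Rightarrow> nat) \<Rightarrow> ereal" where
  "H_lower k l S = ereal (1 / (real l * log 2 (real k))) *
     liminf (\<lambda>n. ereal (shannon_entropy (words k l) (block_freq S l n)))"

definition H_upper :: "nat \<Rightarrow> nat \<Rightarrow> (nat \<Rightarrow> nat) \<Rightarrow> ereal" where
  "H_upper k l S = ereal (1 / (real l * log 2 (real k))) *
     limsup (\<lambda>n. ereal (shannon_entropy (words k l) (block_freq S l n)))"

definition dim_FS :: "nat \<Rightarrow> (nat \<Rightarrow> nat) \<Rightarrow> ereal" where
  "dim_FS k S = (INF l\<in>{1..}. H_lower k l S)"

definition Dim_FS :: "nat \<Rightarrow> (nat \<Rightarrow> nat) \<Rightarrow> ereal" where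
  "Dim_FS k S = (INF l\<in>{1..}. H_upper k l S)"

text \<open>In \<open>A x y\<close>, \<open>x\<close> is the row index and \<open>y\<close> the column index.\<close>

definition dispersion_witness ::
  "'a set \<Rightarrow> ('a \<Rightarrow> real) \<Rightarrow> ('a \<Rightarrow> real) \<Rightarrow> nat \<Rightarrow> ('a \<Rightarrow> 'a \<Rightarrow> real) \<Rightarrow> bool" where
  "dispersion_witness \<Omega> \<pi> \<mu> m A \<longleftrightarrow>
     (\<forall>x\<in>\<Omega>. \<forall>y\<in>\<Omega>. A x y \<ge> 0) \<and>
     (\<forall>y\<in>\<Omega>. (\<Sum>x\<in>\<Omega>. A x y) = 1) \<and>
     (\<forall>x\<in>\<Omega>. (\<Sum>y\<in>\<Omega>. A x y * \<pi> y) = \<mu> x) \<and>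
     (\<forall>x\<in>\<Omega>. card {y\<in>\<Omega>. A x y \<noteq> 0} \<le> m) \<and>
     (\<forall>y\<in>\<Omega>. card {x\<in>\<Omega>. A x y \<noteq> 0} \<le> m)"

definition log_dispersion :: "'a set \<Rightarrow> ('a \<Rightarrow> real) \<Rightarrow> ('a \<Rightarrow> real) \<Rightarrow> real" where
  "log_dispersion \<Omega> \<pi> \<mu> = log 2 (real (LEAST m. m > 0 \<and> (\<exists>A. dispersion_witness \<Omega> \<pi> \<mu> m A)))"

definition upper_dispersion :: "nat \<Rightarrow> (nat \<Rightarrow> nat) \<Rightarrow> (nat \<Rightarrow> nat) \<Rightarrow> ereal" where
  "upper_dispersion k S T =
     limsup (\<lambda>l. ereal (1 / (real l * log 2 (real k))) *
       limsup (\<lambda>n. ereal (log_dispersion (words k l) (block_freq S l n) (block_freq T l n))))"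

text \<open>The minimum in \<open>log_dispersion\<close> ranges over a nonempty set.\<close>

lemma dispersion_witness_card:
  assumes "finite \<Omega>" "\<forall>x\<in>\<Omega>. \<mu> x \<ge> 0" "sum \<mu> \<Omega> = 1" "sum \<pi> \<Omega> = 1"
  shows "dispersion_witness \<Omega> \<pi> \<mu> (card \<Omega>) (\<lambda>x y. \<mu> x)"
  using assms unfolding dispersion_witness_def
  by (auto simp: sum_distrib_left[symmetric] intro!: card_mono)

lemma finite_words: "finite (words k l)"
  unfolding words_def by (rule finite_lists_length_eq) simp

lemma block_in_words:
  assumes "range S \<subseteq> {..<k}"
  shows "block S l j \<in> words k l"
  using assms unfolding words_def block_def by (auto simp: algebra_simps)

lemma sum_block_freq:
  assumes "range S \<subseteq> {..<k}" "n > 0"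
  shows "(\<Sum>w\<in>words k l. block_freq S l n w) = 1"
proof -
  have "(\<Sum>w\<in>words k l. card {j\<in>{..<n}. block S l j = w}) = (\<Sum>w\<in>words k l. \<Sum>j | j \<in> {..<n} \<and> block S l j = w. 1)"
    by simp
  also have "\<dots> = (\<Sum>j<n. 1)"
    by (rule sum.group) (use block_in_words[OF assms(1)] in \<open>auto simp: finite_words\<close>)
  finally have "(\<Sum>w\<in>words k l. card {j. j < n \<and> block S l j = w}) = n"
    by simp
  then show ?thesis
    using assms(2) unfolding block_freq_def
    by (simp add: sum_divide_distrib[symmetric] of_nat_sum[symmetric] del: of_nat_sum)
qed

end

theory Submission
  imports Defs "HOL-Analysis.Extended_Real_Limits"
begin

text \<open>
  If a column-stochastic matrix carries \<open>\<pi>\<close> to \<open>\<mu>\<close> with at most \<open>m\<close> nonzero entries per row and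
  column, then it couples \<open>\<pi>\<close> and \<open>\<mu>\<close> so that each of the two variables takes at most \<open>m\<close> values
  given the other. Hence the entropies of \<open>\<pi>\<close> and \<open>\<mu>\<close> differ by at most \<open>log m\<close>, which bounds the
  difference of the block entropy rates at each fixed \<open>l\<close>. To replace the bounds at fixed \<open>l\<close> by
  the upper limit over \<open>l\<close>, one uses that the block entropy rates do not increase when \<open>l\<close> is
  doubled (subadditivity of entropy), so the infimum over \<open>l\<close> is already approached along the
  multiples \<open>2^i * l\<close>.
\<close>

section \<open>Entropy inequalities\<close>

lemma log2_le_minus_one:
  assumes "(z::real) > 0"
  shows "log 2 z \<le> (z - 1) / ln 2"
  using ln_le_minus_one[OF assms] by (simp add: log_def divide_right_mono)

text \<open>The tangent bound for the logarithm at \<open>q x / p x\<close> leaves the correction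
  \<open>(q x - p x) / ln 2\<close>, and these corrections sum to at most 0. The last hypothesis
  excludes points with \<open>q x = 0 < p x\<close>, where the cross entropy is really infinite but
  division by zero would give the right-hand side a finite value.\<close>

lemma gibbs_inequality:
  assumes "finite X" "\<And>x. x \<in> X \<Longrightarrow> p x \<ge> 0" "\<And>x. x \<in> X \<Longrightarrow> q x \<ge> 0"
    and "sum p X = 1" "sum q X \<le> 1" "\<And>x. x \<in> X \<Longrightarrow> p x > 0 \<Longrightarrow> q x > 0"
  shows "shannon_entropy X p \<le> (\<Sum>x\<in>X. p x * log 2 (1 / q x))"
proof -
  have "p x * log 2 (1 / p x) \<le> p x * log 2 (1 / q x) + (q x - p x) / ln 2" if "x \<in> X" for x
  proof (cases "p x = 0")
    case True
    then show ?thesis using assms(3)[OF that] by simp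
  next
    case False
    then have pos: "p x > 0" "q x > 0"
      using assms(2,6)[OF that] by auto
    have "p x * log 2 (q x / p x) \<le> p x * ((q x / p x - 1) / ln 2)"
      using log2_le_minus_one[of "q x / p x"] pos by (intro mult_left_mono) auto
    also have "\<dots> = (q x - p x) / ln 2"
      using pos by (simp add: field_simps)
    finally show ?thesis
      using pos by (simp add: log_divide algebra_simps)
  qed
  then have "shannon_entropy X p \<le> (\<Sum>x\<in>X. p x * log 2 (1 / q x) + (q x - p x) / ln 2)"
    unfolding shannon_entropy_def by (rule sum_mono)
  also have "\<dots> = (\<Sum>x\<in>X. p x * log 2 (1 / q x)) + (sum q X - sum p X) / ln 2"
    by (simp add: sum.distrib sum_divide_distrib[symmetric] sum_subtractf)
  also have "(sum q X - sum p X) / ln 2 \<le> 0"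
    using assms(4,5) by (simp add: divide_nonpos_pos)
  finally show ?thesis by simp
qed

lemma shannon_entropy_nonneg:
  assumes "\<And>x. x \<in> X \<Longrightarrow> 0 \<le> p x" "\<And>x. x \<in> X \<Longrightarrow> p x \<le> 1"
  shows "shannon_entropy X p \<ge> 0"
  unfolding shannon_entropy_def
proof (rule sum_nonneg)
  fix x assume "x \<in> X"
  then show "0 \<le> p x * log 2 (1 / p x)"
    using assms[of x] by (cases "p x = 0") (auto simp: log_divide intro!: mult_nonneg_nonpos)
qed

text \<open>A crude bound, used to see that the entropy rates are finite: by the tangent bound no
  summand exceeds \<open>1 / ln 2\<close>.\<close>

lemma shannon_entropy_le_card:
  assumes "\<And>x. x \<in> X \<Longrightarrow> 0 \<le> p x"
  shows "shannon_entropy X p \<le> real (card X) / ln 2"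
proof -
  have "p x * log 2 (1 / p x) \<le> 1 / ln 2" if "x \<in> X" for x
  proof (cases "p x = 0")
    case False
    then have pos: "p x > 0" using assms[OF that] by simp
    have "p x * log 2 (1 / p x) \<le> p x * ((1 / p x - 1) / ln 2)"
      using log2_le_minus_one[of "1 / p x"] pos by (intro mult_left_mono) auto
    also have "\<dots> \<le> 1 / ln 2"
      using pos by (simp add: field_simps)
    finally show ?thesis .
  qed simp
  then have "shannon_entropy X p \<le> (\<Sum>x\<in>X. 1 / ln 2)"
    unfolding shannon_entropy_def by (rule sum_mono)
  then show ?thesis by simp
qed

text \<open>\<open>J\<close> is a joint distribution with marginals \<open>p\<close> and
  \<open>q\<close>. The entropy of \<open>p\<close> is at most that of \<open>J\<close>, which by
  the chain rule is the entropy of \<open>q\<close> plus a conditional entropy; given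
  \<open>y\<close> at most \<open>m\<close> values of \<open>x\<close> remain, so the latter is at
  most \<open>log 2 m\<close>. The proof merges these facts into one pointwise estimate.\<close>

lemma shannon_entropy_marginal_le:
  fixes J :: "'a \<Rightarrow> 'b \<Rightarrow> real"
  assumes fin: "finite X" "finite Y"
    and J: "\<And>x y. x \<in> X \<Longrightarrow> y \<in> Y \<Longrightarrow> J x y \<ge> 0"
    and p: "\<And>x. x \<in> X \<Longrightarrow> (\<Sum>y\<in>Y. J x y) = p x"
    and q: "\<And>y. y \<in> Y \<Longrightarrow> (\<Sum>x\<in>X. J x y) = q y"
    and total: "sum q Y = 1"
    and card: "\<And>y. y \<in> Y \<Longrightarrow> card {x\<in>X. J x y \<noteq> 0} \<le> m" and "m > 0"
  shows "shannon_entropy X p \<le> shannon_entropy Y q + log 2 (real m)"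
proof -
  \<comment> \<open>The error of the tangent bound at \<open>q y / (m * J x y)\<close>, multiplied
    by \<open>J x y\<close>. It is cut off outside the support of \<open>J\<close> so that a column
    contributes at most \<open>m\<close> terms \<open>q y / m\<close>.\<close>
  define e where "e x y = (if J x y = 0 then 0 else (q y / m - J x y) / ln 2)" for x y
  have pointwise: "J x y * log 2 (1 / p x) \<le>
      J x y * log 2 (1 / q y) + J x y * log 2 m + e x y" if xy: "x \<in> X" "y \<in> Y" for x y
  proof (cases "J x y = 0")
    case False
    then have Jpos: "J x y > 0" using J[OF xy] by simp
    \<comment> \<open>This is the pointwise form of the fact that a marginal has at most the entropy
      of the joint distribution.\<close>
    have Jp: "J x y \<le> p x"
      unfolding p[OF xy(1), symmetric] using fin xy J by (intro member_le_sum) auto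
    have "J x y \<le> q y"
      unfolding q[OF xy(2), symmetric] using fin xy J by (intro member_le_sum) auto
    then have pos: "p x > 0" "q y > 0" using Jp Jpos by auto
    have "log 2 (J x y) \<le> log 2 (p x)"
      using Jpos Jp pos by simp
    moreover have "log 2 (q y / (m * J x y)) \<le> (q y / (m * J x y) - 1) / ln 2"
      using pos Jpos \<open>m > 0\<close> by (intro log2_le_minus_one) auto
    moreover have "log 2 (q y / (m * J x y)) = log 2 (q y) - (log 2 m + log 2 (J x y))"
      "log 2 (1 / p x) = - log 2 (p x)" "log 2 (1 / q y) = - log 2 (q y)"
      using pos Jpos \<open>m > 0\<close> by (simp_all add: log_divide log_mult)
    ultimately have "log 2 (1 / p x) \<le> log 2 (1 / q y) + log 2 m + (q y / (m * J x y) - 1) / ln 2"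
      by linarith
    then have "J x y * log 2 (1 / p x) \<le>
        J x y * (log 2 (1 / q y) + log 2 m + (q y / (m * J x y) - 1) / ln 2)"
      using Jpos by (intro mult_left_mono) auto
    also have "\<dots> = J x y * log 2 (1 / q y) + J x y * log 2 m + e x y"
      using Jpos \<open>m > 0\<close> by (simp add: e_def distrib_left) (simp add: field_simps)
    finally show ?thesis .
  qed (simp add: e_def)
  have q_nonneg: "q y \<ge> 0" if "y \<in> Y" for y
    unfolding q[OF that, symmetric] using J that by (intro sum_nonneg) auto
  \<comment> \<open>Here the support bound enters: at most \<open>m\<close> terms
    \<open>q y / m\<close> add up to at most \<open>q y\<close>, which is the column sum of
    \<open>J\<close>.\<close>
  have e_col: "(\<Sum>x\<in>X. e x y) \<le> 0" if y: "y \<in> Y" for y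
  proof -
    have "(\<Sum>x\<in>X. e x y) = (\<Sum>x\<in>{x\<in>X. J x y \<noteq> 0}. (q y / m - J x y) / ln 2)"
      unfolding e_def using fin by (intro sum.mono_neutral_cong_right) auto
    also have "\<dots> = (card {x\<in>X. J x y \<noteq> 0} * (q y / m) - (\<Sum>x\<in>{x\<in>X. J x y \<noteq> 0}. J x y)) / ln 2"
      by (simp add: sum_divide_distrib[symmetric] sum_subtractf)
    also have "(\<Sum>x\<in>{x\<in>X. J x y \<noteq> 0}. J x y) = q y"
      unfolding q[OF y, symmetric] using fin by (intro sum.mono_neutral_left) auto
    also have "card {x\<in>X. J x y \<noteq> 0} * (q y / m) \<le> real m * (q y / m)"
      using card[OF y] q_nonneg[OF y] by (intro mult_right_mono) auto
    then have "(card {x\<in>X. J x y \<noteq> 0} * (q y / m) - q y) / ln 2 \<le> 0"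
      using \<open>m > 0\<close> by (simp add: divide_nonpos_pos)
    finally show ?thesis .
  qed
  have "shannon_entropy X p = (\<Sum>x\<in>X. \<Sum>y\<in>Y. J x y * log 2 (1 / p x))"
    unfolding shannon_entropy_def by (simp add: p[symmetric] sum_distrib_right)
  also have "\<dots> \<le> (\<Sum>x\<in>X. \<Sum>y\<in>Y. J x y * log 2 (1 / q y) + J x y * log 2 m + e x y)"
    using pointwise by (intro sum_mono) auto
  also have "\<dots> = (\<Sum>y\<in>Y. \<Sum>x\<in>X. J x y * log 2 (1 / q y) + J x y * log 2 m + e x y)"
    by (rule sum.swap)
  also have "\<dots> = (\<Sum>y\<in>Y. q y * log 2 (1 / q y) + q y * log 2 m + (\<Sum>x\<in>X. e x y))"
    by (intro sum.cong refl) (simp add: sum.distrib sum_distrib_right[symmetric] q)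
  also have "\<dots> \<le> (\<Sum>y\<in>Y. q y * log 2 (1 / q y) + q y * log 2 m)"
    using e_col by (intro sum_mono) auto
  also have "\<dots> = shannon_entropy Y q + log 2 m"
    using total by (simp add: shannon_entropy_def sum.distrib sum_distrib_right[symmetric])
  finally show ?thesis .
qed

lemma shannon_entropy_log_dispersion:
  assumes fin: "finite \<Omega>"
    and pi: "\<And>x. x \<in> \<Omega> \<Longrightarrow> \<pi> x \<ge> 0" "sum \<pi> \<Omega> = 1"
    and mu: "\<And>x. x \<in> \<Omega> \<Longrightarrow> \<mu> x \<ge> 0" "sum \<mu> \<Omega> = 1"
  shows "shannon_entropy \<Omega> \<mu> \<le> shannon_entropy \<Omega> \<pi> + log_dispersion \<Omega> \<pi> \<mu>"
    and "shannon_entropy \<Omega> \<pi> \<le> shannon_entropy \<Omega> \<mu> + log_dispersion \<Omega> \<pi> \<mu>"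
    and "log_dispersion \<Omega> \<pi> \<mu> \<ge> 0"
proof -
  define m where "m = (LEAST m. m > 0 \<and> (\<exists>A. dispersion_witness \<Omega> \<pi> \<mu> m A))"
  \<comment> \<open>Some admissible \<open>m\<close> exists, so the \<open>LEAST\<close> in the
    dispersion is attained by an actual matrix.\<close>
  have "card \<Omega> > 0"
    using fin pi(2) by (auto simp: card_gt_0_iff)
  moreover have "dispersion_witness \<Omega> \<pi> \<mu> (card \<Omega>) (\<lambda>x y. \<mu> x)"
    using fin pi mu by (intro dispersion_witness_card) auto
  ultimately have "m > 0 \<and> (\<exists>A. dispersion_witness \<Omega> \<pi> \<mu> m A)"
    unfolding m_def by (intro LeastI_ex[where P = "\<lambda>m. m > 0 \<and> (\<exists>A. dispersion_witness \<Omega> \<pi> \<mu> m A)"]) blast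
  then obtain A where m: "m > 0" and A: "dispersion_witness \<Omega> \<pi> \<mu> m A"
    by auto
  have delta: "log_dispersion \<Omega> \<pi> \<mu> = log 2 (real m)"
    unfolding log_dispersion_def m_def ..
  show "log_dispersion \<Omega> \<pi> \<mu> \<ge> 0"
    unfolding delta using m by simp
  \<comment> \<open>Weighting the columns by \<open>\<pi>\<close> turns the stochastic matrix into a
    coupling of \<open>\<mu>\<close> (rows) and \<open>\<pi>\<close> (columns); zeros of
    \<open>\<pi>\<close> can only shrink the supports.\<close>
  define J where "J x y = A x y * \<pi> y" for x y
  have J: "J x y \<ge> 0" if "x \<in> \<Omega>" "y \<in> \<Omega>" for x y
    using A that pi(1) by (auto simp: J_def dispersion_witness_def)
  have row: "(\<Sum>y\<in>\<Omega>. J x y) = \<mu> x" if "x \<in> \<Omega>" for x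
    using A that by (auto simp: J_def dispersion_witness_def)
  have col: "(\<Sum>x\<in>\<Omega>. J x y) = \<pi> y" if "y \<in> \<Omega>" for y
    using A that by (auto simp: J_def dispersion_witness_def sum_distrib_right[symmetric])
  have card_row: "card {y\<in>\<Omega>. J x y \<noteq> 0} \<le> m" if "x \<in> \<Omega>" for x
  proof -
    have "card {y\<in>\<Omega>. J x y \<noteq> 0} \<le> card {y\<in>\<Omega>. A x y \<noteq> 0}"
      using fin by (intro card_mono) (auto simp: J_def)
    also have "\<dots> \<le> m"
      using A that by (simp add: dispersion_witness_def)
    finally show ?thesis .
  qed
  have card_col: "card {x\<in>\<Omega>. J x y \<noteq> 0} \<le> m" if "y \<in> \<Omega>" for y
  proof -
    have "card {x\<in>\<Omega>. J x y \<noteq> 0} \<le> card {x\<in>\<Omega>. A x y \<noteq> 0}"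
      using fin by (intro card_mono) (auto simp: J_def)
    also have "\<dots> \<le> m"
      using A that by (simp add: dispersion_witness_def)
    finally show ?thesis .
  qed
  show "shannon_entropy \<Omega> \<mu> \<le> shannon_entropy \<Omega> \<pi> + log_dispersion \<Omega> \<pi> \<mu>"
    unfolding delta
    by (rule shannon_entropy_marginal_le[where J = J])
      (use fin J row col pi(2) card_col m in auto)
  \<comment> \<open>Transposing the coupling exchanges the marginals, and the bound on rows replaces
    the one on columns.\<close>
  show "shannon_entropy \<Omega> \<pi> \<le> shannon_entropy \<Omega> \<mu> + log_dispersion \<Omega> \<pi> \<mu>"
    unfolding delta
    by (rule shannon_entropy_marginal_le[where J = "\<lambda>x y. J y x"])
      (use fin J row col mu(2) card_row m in auto)
qed

section \<open>Block entropies\<close>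

lemma block_freq_nonneg: "block_freq S l n w \<ge> 0"
  by (simp add: block_freq_def)

lemma block_freq_le_1: "block_freq S l n w \<le> 1"
proof -
  have "card {j. j < n \<and> block S l j = w} \<le> card {..<n}"
    by (intro card_mono) auto
  then show ?thesis
    by (simp add: block_freq_def divide_le_eq)
qed

lemma block_freq_pos:
  assumes "j < n" "block S l j = w"
  shows "block_freq S l n w > 0"
proof -
  have "{j. j < n \<and> block S l j = w} \<noteq> {}" using assms by auto
  then show ?thesis
    using assms by (auto simp: block_freq_def card_gt_0_iff)
qed

text \<open>An expectation under the empirical measure is an average along the sequence: group the
  positions \<open>j\<close> by the block found there. This turns entropies into sums over
  positions, which can be split and extended.\<close>

lemma sum_block_freq_mult:
  assumes "range S \<subseteq> {..<k}"
  shows "(\<Sum>w\<in>words k l. block_freq S l n w * f w) = (\<Sum>j<n. f (block S l j)) / n"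
proof -
  have "real (card {j. j < n \<and> block S l j = w}) * f w =
      (\<Sum>j | j \<in> {..<n} \<and> block S l j = w. f (block S l j))" for w
    by simp
  then have "(\<Sum>w\<in>words k l. real (card {j. j < n \<and> block S l j = w}) * f w) =
      (\<Sum>w\<in>words k l. \<Sum>j | j \<in> {..<n} \<and> block S l j = w. f (block S l j))"
    by simp
  also have "\<dots> = (\<Sum>j<n. f (block S l j))"
    by (rule sum.group) (use block_in_words[OF assms] in \<open>auto simp: finite_words\<close>)
  finally show ?thesis
    by (simp add: block_freq_def sum_divide_distrib[symmetric])
qed

lemma block_double: "block S (2 * l) j = block S l (2 * j) @ block S l (2 * j + 1)"
proof -
  have "[j * (2 * l)..<(j + 1) * (2 * l)] =
      [2 * j * l..<(2 * j + 1) * l] @ [(2 * j + 1) * l..<(2 * j + 1 + 1) * l]"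
    using upt_add_eq_append[of "2 * j * l" "(2 * j + 1) * l" l]
    by (simp add: algebra_simps)
  then show ?thesis
    by (simp add: block_def)
qed

lemma length_block: "length (block S l j) = l"
  by (simp add: block_def)

text \<open>Cutting a word in the middle is a bijection onto pairs of words. It serves to compute
  the total mass of a product measure.\<close>

lemma sum_words_double:
  "(\<Sum>w\<in>words k (2 * l). f (take l w) * g (drop l w)) =
    (\<Sum>u\<in>words k l. f u) * (\<Sum>v\<in>words k l. g v :: real)"
proof -
  have "(\<Sum>w\<in>words k (2 * l). f (take l w) * g (drop l w)) =
      (\<Sum>(u, v)\<in>words k l \<times> words k l. f u * g v)"
    by (rule sum.reindex_bij_witness[of _ "\<lambda>(u, v). u @ v" "\<lambda>w. (take l w, drop l w)"])
      (auto simp: words_def dest: in_set_takeD in_set_dropD)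
  then show ?thesis
    by (simp add: sum_product sum.cartesian_product)
qed

abbreviation block_entropy :: "nat \<Rightarrow> nat \<Rightarrow> (nat \<Rightarrow> nat) \<Rightarrow> nat \<Rightarrow> real" where
  "block_entropy k l S n \<equiv> shannon_entropy (words k l) (block_freq S l n)"

lemma block_entropy_nonneg: "block_entropy k l S n \<ge> 0"
  by (intro shannon_entropy_nonneg block_freq_nonneg block_freq_le_1)

text \<open>
  Gibbs' inequality against the product of the length-\<open>l\<close> frequencies. Allowing \<open>N > 2 * n\<close> makes
  it possible to compare with all \<open>N\<close>, not only with the even ones, which the lower limit needs.
\<close>

lemma block_entropy_double:
  assumes S: "range S \<subseteq> {..<k}" and n: "n > 0" "2 * n \<le> N"
  shows "n * block_entropy k (2 * l) S n \<le> N * block_entropy k l S N"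
proof -
  define Q where "Q = block_freq S l N"
  have Q_pos: "Q (block S l j) > 0" if "j < N" for j
    unfolding Q_def using that by (intro block_freq_pos) auto
  have Q_sum: "sum Q (words k l) = 1"
    unfolding Q_def using n by (intro sum_block_freq[OF S]) auto
  have "block_entropy k (2 * l) S n \<le>
      (\<Sum>w\<in>words k (2 * l). block_freq S (2 * l) n w * log 2 (1 / (Q (take l w) * Q (drop l w))))"
  proof (rule gibbs_inequality)
    show "sum (block_freq S (2 * l) n) (words k (2 * l)) = 1"
      using n by (intro sum_block_freq[OF S]) auto
    show "(\<Sum>w\<in>words k (2 * l). Q (take l w) * Q (drop l w)) \<le> 1"
      by (simp add: sum_words_double Q_sum)
    \<comment> \<open>A word of positive frequency occurs at some \<open>j < n\<close>, so its
      halves occur at positions \<open>2 * j\<close> and \<open>2 * j + 1\<close>, both below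
      \<open>N\<close>.\<close>
    fix w assume "block_freq S (2 * l) n w > 0"
    then have "{j. j < n \<and> block S (2 * l) j = w} \<noteq> {}"
      by (auto simp: block_freq_def simp del: Collect_empty_eq)
    then obtain j where j: "j < n" "block S (2 * l) j = w"
      by auto
    have "Q (block S l (2 * j)) > 0" "Q (block S l (2 * j + 1)) > 0"
      using j n by (auto intro!: Q_pos simp del: One_nat_def)
    then show "Q (take l w) * Q (drop l w) > 0"
      unfolding j(2)[symmetric] block_double by (simp add: length_block)
  qed (auto simp: finite_words block_freq_nonneg Q_def)
  also have "\<dots> = (\<Sum>j<n. log 2 (1 / (Q (block S l (2 * j)) * Q (block S l (2 * j + 1))))) / n"
    by (simp add: sum_block_freq_mult[OF S] block_double length_block)
  also have "\<dots> = (\<Sum>j<n. log 2 (1 / Q (block S l (2 * j))) + log 2 (1 / Q (block S l (2 * j + 1)))) / n"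
  proof (intro arg_cong2[where f = "(/)"] sum.cong refl)
    fix j assume "j \<in> {..<n}"
    then have "Q (block S l (2 * j)) > 0" "Q (block S l (2 * j + 1)) > 0"
      using n by (auto intro!: Q_pos simp del: One_nat_def)
    then show "log 2 (1 / (Q (block S l (2 * j)) * Q (block S l (2 * j + 1)))) =
        log 2 (1 / Q (block S l (2 * j))) + log 2 (1 / Q (block S l (2 * j + 1)))"
      by (simp add: log_divide log_mult)
  qed
  \<comment> \<open>Even and odd positions together exhaust the first \<open>2 * n\<close> blocks of
    length \<open>l\<close>.\<close>
  also have "(\<Sum>j<n. log 2 (1 / Q (block S l (2 * j))) + log 2 (1 / Q (block S l (2 * j + 1)))) =
      (\<Sum>j<2 * n. log 2 (1 / Q (block S l j)))"
    by (induction n) auto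
  finally have "n * block_entropy k (2 * l) S n \<le> (\<Sum>j<2 * n. log 2 (1 / Q (block S l j)))"
    using n by (simp add: field_simps)
  \<comment> \<open>The blocks from \<open>2 * n\<close> to \<open>N - 1\<close> add nonnegative
    terms, since \<open>Q\<close> is at most 1.\<close>
  also have "\<dots> \<le> (\<Sum>j<N. log 2 (1 / Q (block S l j)))"
  proof (rule sum_mono2)
    fix j assume "j \<in> {..<N} - {..<2 * n}"
    then have "Q (block S l j) > 0" "Q (block S l j) \<le> 1"
      using Q_pos by (auto simp: Q_def block_freq_le_1)
    then show "log 2 (1 / Q (block S l j)) \<ge> 0"
      by (simp add: log_divide)
  qed (use n in auto)
  also have "\<dots> = N * block_entropy k l S N"
    using n by (simp add: shannon_entropy_def sum_block_freq_mult[OF S] Q_def)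
  finally show ?thesis .
qed

section \<open>Limits\<close>

text \<open>Doubling is applied with \<open>N = 2 * n\<close>; an upper limit along the even indices
  is at most the full upper limit.\<close>

lemma limsup_block_entropy_double:
  assumes "range S \<subseteq> {..<k}"
  shows "limsup (\<lambda>n. ereal (block_entropy k (2 * l) S n)) \<le>
    ereal 2 * limsup (\<lambda>n. ereal (block_entropy k l S n))"
proof -
  have "limsup (\<lambda>n. ereal (block_entropy k (2 * l) S n)) \<le>
      limsup (\<lambda>n. ereal 2 * ereal (block_entropy k l S (2 * n)))"
  proof (rule Limsup_mono, rule eventually_mono[OF eventually_gt_at_top[of 0]])
    fix n :: nat assume "0 < n"
    then show "ereal (block_entropy k (2 * l) S n) \<le> ereal 2 * ereal (block_entropy k l S (2 * n))"
      using block_entropy_double[OF assms, of n "2 * n" l] by simp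
  qed
  also have "\<dots> = ereal 2 * limsup ((\<lambda>n. ereal (block_entropy k l S n)) \<circ> (\<lambda>n. 2 * n))"
    by (subst limsup_ereal_mult_left) (auto simp: o_def)
  also have "\<dots> \<le> ereal 2 * limsup (\<lambda>n. ereal (block_entropy k l S n))"
    by (intro ereal_mult_left_mono limsup_subseq_mono) (auto simp: strict_mono_def)
  finally show ?thesis .
qed

text \<open>Eventual lower bounds survive any reindexing that tends to infinity. Strict monotonicity
  is not assumed because \<open>N div 2\<close>, the case of interest, takes every value
  twice.\<close>

lemma liminf_le_liminf_compose:
  fixes f :: "nat \<Rightarrow> ereal"
  assumes "filterlim r sequentially sequentially"
  shows "liminf f \<le> liminf (\<lambda>n. f (r n))"
  unfolding le_Liminf_iff
proof (intro allI impI)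
  fix y assume "y < liminf f"
  then have "\<forall>\<^sub>F n in sequentially. y < f n"
    by (rule less_LiminfD)
  then show "\<forall>\<^sub>F n in sequentially. y < f (r n)"
    using assms by (auto simp: filterlim_iff)
qed

text \<open>The lower limit along even indices may exceed the full one, so every \<open>N\<close> is
  compared with \<open>n = N div 2\<close>. The price is the factor \<open>N / (N div 2)\<close>,
  which tends to 2.\<close>

lemma liminf_block_entropy_double:
  assumes "range S \<subseteq> {..<k}"
  shows "liminf (\<lambda>n. ereal (block_entropy k (2 * l) S n)) \<le>
    ereal 2 * liminf (\<lambda>n. ereal (block_entropy k l S n))"
proof -
  have half: "filterlim (\<lambda>N::nat. N div 2) sequentially sequentially"
    unfolding filterlim_at_top
  proof
    fix Z :: nat
    show "\<forall>\<^sub>F N in sequentially. Z \<le> N div 2"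
      using eventually_ge_at_top[of "2 * Z"] by eventually_elim simp
  qed
  have "liminf (\<lambda>n. ereal (block_entropy k (2 * l) S n)) \<le>
      liminf (\<lambda>N. ereal (block_entropy k (2 * l) S (N div 2)))"
    by (rule liminf_le_liminf_compose[OF half])
  also have "\<dots> \<le> liminf (\<lambda>N. ereal (real N / real (N div 2)) * ereal (block_entropy k l S N))"
  proof (rule Liminf_mono, rule eventually_mono[OF eventually_ge_at_top[of 2]])
    fix N :: nat assume "N \<ge> 2"
    then have "N div 2 > 0" by linarith
    then show "ereal (block_entropy k (2 * l) S (N div 2)) \<le>
        ereal (real N / real (N div 2)) * ereal (block_entropy k l S N)"
      using block_entropy_double[OF assms, of "N div 2" N l] by (simp add: field_simps)
  qed
  also have "\<dots> = ereal 2 * liminf (\<lambda>n. ereal (block_entropy k l S n))"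
  proof (rule ereal_liminf_lim_mult)
    have "(\<lambda>N. real N / real (N div 2)) \<longlonglongrightarrow> 2"
    \<comment> \<open>Both bounds come from
      \<open>2 * (N div 2) \<le> N \<le> 2 * (N div 2) + 1\<close>.\<close>
    proof (rule real_tendsto_sandwich)
      show "\<forall>\<^sub>F N in sequentially. 2 \<le> real N / real (N div 2)"
        using eventually_ge_at_top[of 2]
      proof eventually_elim
        case (elim N)
        then have "2 * (N div 2) \<le> N" "N div 2 > 0" by linarith+
        then have "2 * real (N div 2) \<le> real N" "real (N div 2) > 0" by linarith+
        then show ?case by (simp add: field_simps)
      qed
      show "\<forall>\<^sub>F N in sequentially. real N / real (N div 2) \<le> 2 + 1 / real (N div 2)"
        using eventually_ge_at_top[of 2]
      proof eventually_elim
        case (elim N)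
        then have "N \<le> 2 * (N div 2) + 1" "N div 2 > 0" by linarith+
        then have "real N \<le> 2 * real (N div 2) + 1" "real (N div 2) > 0" by linarith+
        then show ?case by (simp add: field_simps)
      qed
      have "(\<lambda>N. 1 / real (N div 2)) \<longlonglongrightarrow> 0"
        using filterlim_compose[OF lim_1_over_n half] by simp
      from tendsto_add[OF tendsto_const[of 2] this]
      show "(\<lambda>N. 2 + 1 / real (N div 2)) \<longlonglongrightarrow> 2" by simp
    qed simp
    then show "(\<lambda>N. ereal (real N / real (N div 2))) \<longlonglongrightarrow> ereal 2"
      by simp
  qed auto
  finally show ?thesis .
qed

text \<open>The term \<open>d\<close> is controlled only for large \<open>l\<close>, whereas the
  infimum of \<open>f\<close> may be reached at a small \<open>l\<close>. Passing to
  \<open>2 ^ i * l\<close> does not increase \<open>f\<close>, and along this subsequence the upper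
  limit of \<open>d\<close> is at most \<open>limsup d\<close>.\<close>

lemma INF_le_INF_add_limsup:
  fixes f g d :: "nat \<Rightarrow> ereal"
  assumes f: "\<And>l. f l \<ge> 0" and d: "\<And>l. d l \<ge> 0"
    and double: "\<And>l. l \<ge> 1 \<Longrightarrow> f (2 * l) \<le> f l"
    and le: "\<And>l. l \<ge> 1 \<Longrightarrow> g l \<le> f l + d l"
  shows "(INF l\<in>{1..}. g l) \<le> (INF l\<in>{1..}. f l) + limsup d"
proof -
  have D: "limsup d \<ge> 0"
    using d by (intro le_Limsup) auto
  have "(INF l\<in>{1..}. g l) \<le> f l + limsup d" if l: "l \<ge> 1" for l
  proof -
    have pow: "f (2 ^ i * l) \<le> f l" for i
    proof (induction i)
      case (Suc i)
      have "f (2 * (2 ^ i * l)) \<le> f (2 ^ i * l)"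
        using l by (intro double) simp
      with Suc show ?case by (simp add: mult.assoc)
    qed simp
    have "(INF l\<in>{1..}. g l) \<le> f l + d (2 ^ i * l)" for i
    proof -
      have pos: "2 ^ i * l \<ge> 1" using l by simp
      then have "(INF l\<in>{1..}. g l) \<le> g (2 ^ i * l)"
        by (intro INF_lower) simp
      also have "\<dots> \<le> f (2 ^ i * l) + d (2 ^ i * l)"
        by (rule le[OF pos])
      also have "\<dots> \<le> f l + d (2 ^ i * l)"
        by (intro add_right_mono pow)
      finally show ?thesis .
    qed
    then have "(INF l\<in>{1..}. g l) \<le> limsup (\<lambda>i. f l + d (2 ^ i * l))"
      by (intro le_Limsup) auto
    also have "\<dots> \<le> limsup (\<lambda>i. f l) + limsup (\<lambda>i. d (2 ^ i * l))"
      by (rule ereal_limsup_add_mono)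
    also have "limsup (\<lambda>i. f l) = f l"
      by (simp add: Limsup_const)
    also have "limsup (\<lambda>i. d (2 ^ i * l)) \<le> limsup d"
      using limsup_subseq_mono[of "\<lambda>i. 2 ^ i * l" d] l by (simp add: strict_mono_def o_def)
    finally show ?thesis by (simp add: add_left_mono)
  qed
  then have "(INF l\<in>{1..}. g l) \<le> (INF l\<in>{1..}. f l + limsup d)"
    by (intro INF_greatest) auto
  \<comment> \<open>Nonnegativity rules out the value \<open>-\<infinity>\<close>, so the constant
    can be taken out of the infimum in \<open>ereal\<close>.\<close>
  also have "\<dots> = (INF l\<in>{1..}. f l) + limsup d"
    using D f by (intro INF_ereal_add_left) auto
  finally show ?thesis .
qed

section \<open>Normalized entropy rates and dimensions\<close>

lemma rate_const_nonneg: "k \<ge> 2 \<Longrightarrow> 1 / (real l * log 2 (real k)) \<ge> 0"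
  by simp

lemma H_lower_nonneg: "k \<ge> 2 \<Longrightarrow> H_lower k l S \<ge> 0"
  unfolding H_lower_def
  by (intro ereal_0_le_mult Liminf_bounded) (auto intro!: block_entropy_nonneg always_eventually)

lemma H_lower_le_H_upper: "k \<ge> 2 \<Longrightarrow> H_lower k l S \<le> H_upper k l S"
  unfolding H_lower_def H_upper_def
  by (intro ereal_mult_left_mono Liminf_le_Limsup) auto

lemma H_upper_finite:
  assumes "k \<ge> 2"
  shows "H_upper k l S < \<infinity>"
proof -
  have "limsup (\<lambda>n. ereal (block_entropy k l S n)) \<le> ereal (real (card (words k l)) / ln 2)"
    by (intro Limsup_bounded always_eventually allI)
      (simp add: shannon_entropy_le_card block_freq_nonneg)
  then have "H_upper k l S \<le>
      ereal (1 / (real l * log 2 (real k))) * ereal (real (card (words k l)) / ln 2)"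
    unfolding H_upper_def using rate_const_nonneg[OF assms, of l]
    by (intro ereal_mult_left_mono) auto
  then show ?thesis by (auto simp: le_less_trans)
qed

text \<open>The doubled length in the normalization absorbs the factor 2. At \<open>l = 0\<close>
  both constants are \<open>1 / 0 = 0\<close>.\<close>

lemma rate_double:
  fixes x y :: ereal
  assumes "k \<ge> 2" "x \<le> ereal 2 * y"
  shows "ereal (1 / (real (2 * l) * log 2 (real k))) * x \<le> ereal (1 / (real l * log 2 (real k))) * y"
proof -
  have "ereal (1 / (real (2 * l) * log 2 (real k))) * x \<le>
      ereal (1 / (real (2 * l) * log 2 (real k))) * (ereal 2 * y)"
    using assms rate_const_nonneg[of k "2 * l"] by (intro ereal_mult_left_mono) auto
  also have "\<dots> = (ereal (1 / (real (2 * l) * log 2 (real k))) * ereal 2) * y"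
    by (simp only: mult.assoc)
  also have "ereal (1 / (real (2 * l) * log 2 (real k))) * ereal 2 = ereal (1 / (real l * log 2 (real k)))"
    by simp
  finally show ?thesis .
qed

lemma H_lower_double:
  assumes "k \<ge> 2" "range S \<subseteq> {..<k}"
  shows "H_lower k (2 * l) S \<le> H_lower k l S"
  unfolding H_lower_def
  by (rule rate_double[OF assms(1) liminf_block_entropy_double[OF assms(2)]])

lemma H_upper_double:
  assumes "k \<ge> 2" "range S \<subseteq> {..<k}"
  shows "H_upper k (2 * l) S \<le> H_upper k l S"
  unfolding H_upper_def
  by (rule rate_double[OF assms(1) limsup_block_entropy_double[OF assms(2)]])

text \<open>The signs of \<open>y\<close> and \<open>z\<close> make multiplication distribute over
  their sum even when one of them is infinite.\<close>

lemma rate_add_le: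
  fixes x y z :: ereal
  assumes "k \<ge> 2" "x \<le> y + z" "y \<ge> 0" "z \<ge> 0"
  shows "ereal (1 / (real l * log 2 (real k))) * x \<le>
    ereal (1 / (real l * log 2 (real k))) * y + ereal (1 / (real l * log 2 (real k))) * z"
proof -
  have "ereal (1 / (real l * log 2 (real k))) * x \<le> ereal (1 / (real l * log 2 (real k))) * (y + z)"
    using assms rate_const_nonneg[of k l] by (intro ereal_mult_left_mono) auto
  also have "\<dots> = ereal (1 / (real l * log 2 (real k))) * y + ereal (1 / (real l * log 2 (real k))) * z"
    using assms by (intro ereal_right_distrib) auto
  finally show ?thesis .
qed

text \<open>The bound \<open>\<delta>\<close> is left abstract so that the dispersion from one
  sequence to the other can serve in both directions. The case \<open>n = 0\<close> is excluded
  because \<open>block_freq\<close> then vanishes identically and is no probability measure.\<close>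

lemma dimensions_le_add:
  fixes \<delta> :: "nat \<Rightarrow> nat \<Rightarrow> real"
  assumes k: "k \<ge> 2" and S: "range S \<subseteq> {..<k}"
    and \<delta>: "\<And>l n. n > 0 \<Longrightarrow> \<delta> l n \<ge> 0"
    and le: "\<And>l n. n > 0 \<Longrightarrow> block_entropy k l T n \<le> block_entropy k l S n + \<delta> l n"
  defines "D \<equiv> limsup (\<lambda>l. ereal (1 / (real l * log 2 (real k))) * limsup (\<lambda>n. ereal (\<delta> l n)))"
  shows "dim_FS k T \<le> dim_FS k S + D" and "Dim_FS k T \<le> Dim_FS k S + D"
proof -
  have \<delta>_lim: "limsup (\<lambda>n. ereal (\<delta> l n)) \<ge> 0" for l
    using \<delta> by (intro le_Limsup eventually_mono[OF eventually_gt_at_top[of 0]]) auto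
  then have d: "ereal (1 / (real l * log 2 (real k))) * limsup (\<lambda>n. ereal (\<delta> l n)) \<ge> 0" for l
    using rate_const_nonneg[OF k, of l] by (intro ereal_0_le_mult) auto
  have ev: "\<forall>\<^sub>F n in sequentially. ereal (block_entropy k l T n) \<le>
      ereal (block_entropy k l S n) + ereal (\<delta> l n)" for l
    using le by (intro eventually_mono[OF eventually_gt_at_top[of 0]]) auto
  have ent_nonneg: "liminf (\<lambda>n. ereal (block_entropy k l S n)) \<ge> 0" for l
    by (intro Liminf_bounded) (auto intro!: block_entropy_nonneg always_eventually)
  have "H_lower k l T \<le> H_lower k l S +
      ereal (1 / (real l * log 2 (real k))) * limsup (\<lambda>n. ereal (\<delta> l n))" for l
    unfolding H_lower_def
  proof (rule rate_add_le[OF k _ ent_nonneg \<delta>_lim])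
    \<comment> \<open>A lower limit of a sum is at most the lower limit of one summand plus the
      upper limit of the other; hence the upper limit of the dispersion over \<open>n\<close>
      controls the lower dimension too.\<close>
    show "liminf (\<lambda>n. ereal (block_entropy k l T n)) \<le>
        liminf (\<lambda>n. ereal (block_entropy k l S n)) + limsup (\<lambda>n. ereal (\<delta> l n))"
      by (rule order_trans[OF Liminf_mono[OF ev] ereal_liminf_limsup_add])
  qed
  then show "dim_FS k T \<le> dim_FS k S + D"
    unfolding dim_FS_def D_def
    by (intro INF_le_INF_add_limsup H_lower_nonneg k d H_lower_double S) auto
  have "H_upper k l T \<le> H_upper k l S +
      ereal (1 / (real l * log 2 (real k))) * limsup (\<lambda>n. ereal (\<delta> l n))" for l
    unfolding H_upper_def
  proof (rule rate_add_le[OF k _ _ \<delta>_lim])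
    show "limsup (\<lambda>n. ereal (block_entropy k l T n)) \<le>
        limsup (\<lambda>n. ereal (block_entropy k l S n)) + limsup (\<lambda>n. ereal (\<delta> l n))"
      by (rule order_trans[OF Limsup_mono[OF ev] ereal_limsup_add_mono])
    show "limsup (\<lambda>n. ereal (block_entropy k l S n)) \<ge> 0"
      by (rule order_trans[OF ent_nonneg Liminf_le_Limsup]) simp
  qed
  then show "Dim_FS k T \<le> Dim_FS k S + D"
    unfolding Dim_FS_def D_def
    by (intro INF_le_INF_add_limsup order_trans[OF H_lower_nonneg H_lower_le_H_upper]
        k d H_upper_double S) auto
qed

text \<open>Both values lie between 0 and the upper rate at \<open>l = 1\<close>, so their
  differences in \<open>ereal\<close> are ordinary ones.\<close>

lemma dimensions_finite:
  assumes "k \<ge> 2"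
  shows "\<bar>dim_FS k S\<bar> \<noteq> \<infinity>" and "\<bar>Dim_FS k S\<bar> \<noteq> \<infinity>"
proof -
  have low: "0 \<le> dim_FS k S"
    unfolding dim_FS_def by (intro INF_greatest H_lower_nonneg assms)
  have mid: "dim_FS k S \<le> Dim_FS k S"
    unfolding dim_FS_def Dim_FS_def by (intro INF_mono') (rule H_lower_le_H_upper[OF assms])
  have "Dim_FS k S \<le> H_upper k 1 S"
    unfolding Dim_FS_def by (intro INF_lower) simp
  then have high: "Dim_FS k S < \<infinity>"
    using H_upper_finite[OF assms] by (rule le_less_trans)
  show "\<bar>dim_FS k S\<bar> \<noteq> \<infinity>" "\<bar>Dim_FS k S\<bar> \<noteq> \<infinity>"
    using low mid high by auto
qed

lemma ereal_abs_diff_le: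
  fixes a b c :: ereal
  assumes "\<bar>a\<bar> \<noteq> \<infinity>" "\<bar>b\<bar> \<noteq> \<infinity>" "a \<le> b + c" "b \<le> a + c"
  shows "\<bar>a - b\<bar> \<le> c"
  using assms by (cases a; cases b; cases c) auto

theorem theorem1:
  fixes k :: nat and S T :: "nat \<Rightarrow> nat"
  assumes "k \<ge> 2"
    and "range S \<subseteq> {..<k}"
    and "range T \<subseteq> {..<k}"
  shows "\<bar>dim_FS k S - dim_FS k T\<bar> \<le> upper_dispersion k S T \<and>
         \<bar>Dim_FS k S - Dim_FS k T\<bar> \<le> upper_dispersion k S T"
proof -
  let ?\<delta> = "\<lambda>l n. log_dispersion (words k l) (block_freq S l n) (block_freq T l n)"
  note ent = shannon_entropy_log_dispersion[OF finite_words block_freq_nonneg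
      sum_block_freq[OF assms(2)] block_freq_nonneg sum_block_freq[OF assms(3)]]
  \<comment> \<open>The same dispersion from \<open>S\<close> to \<open>T\<close> is used in
    \<open>T_le\<close> and \<open>S_le\<close>; \<open>ent(1)\<close> and \<open>ent(2)\<close> are
    the two directions of the entropy comparison.\<close>
  note T_le = dimensions_le_add[where \<delta> = ?\<delta>, OF assms(1,2) ent(3) ent(1), folded upper_dispersion_def]
  note S_le = dimensions_le_add[where \<delta> = ?\<delta>, OF assms(1,3) ent(3) ent(2), folded upper_dispersion_def]
  show ?thesis
    by (intro conjI ereal_abs_diff_le T_le S_le dimensions_finite assms(1))
qed

end
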